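(* Let $F$ be the face $(U_{3,4},U_{1,3}^{123})$ of $\Gamma_4$. For real $a,b\ge 0$, the point $\mathbf h=(a,b)\in F$ is entropic if and only if $a=\log v$ for some integer $v\ge 1$.
   Context: $N_4=\{1,2,3,4\}$. $\Gamma_4$ is the cone of all polymatroid rank functions on $N_4$. A set function $\mathbf h:2^{N_4}\to\mathbb R$ is called entropic if there is a random vector $(X_1,X_2,X_3,X_4)$, each $X_i$ taking values in a finite set, with $\mathbf h(A)=H(X_A)$ for all $A\subseteq N_4$, where $H$ is Shannon entropy, $X_A=(X_j,j\in A)$ and $\mathbf h(\emptyset)=0$. Logarithms (also in the entropy) are to base $2$. For two (poly)matroids $M_1,M_2$ on $N_4$ with rank functions $\mathbf r_1,\mathbf r_2$, $(M_1,M_2)$ denotes the face $\{a\mathbf r_1+b\mathbf r_2:a,b\ge0\}$ of $\Gamma_4$, and $(a,b)$ denotes the point $a\mathbf r_1+b\mathbf r_2$. $U_{3,4}$ is the uniform matroid on $N_4$ with $\mathbf r(A)=\min\{3,|A|\}$; $U^{123}_{1,3}$ is the matroid on $N_4$ with $\mathbf r(A)=\min\{1,|A\cap\{1,2,3\}|\}$. *)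

theory Defs
  imports "HOL-Probability.Probability"
begin

text \<open>The ground set \<open>N\<^sub>4 = {1, 2, 3, 4}\<close> is the four-element numeral type \<open>4\<close>, whose elements are
  exactly \<open>1, 2, 3, 4\<close> (in this type the numeral \<open>4\<close> equals \<open>0\<close>).  A set function
  \<open>2\<^bsup>N\<^sub>4\<^esup> \<rightarrow> \<real>\<close> is a vector indexed by the subsets of \<open>N\<^sub>4\<close>, so that
  the library notion \<open>face_of\<close> applies to the polymatroid cone.\<close>

type_synonym setfun4 = "(real, 4 set) vec"

definition polymatroid_cone4 :: "setfun4 set" where
  "polymatroid_cone4 =
     {h. h $ {} = 0 \<and>
         (\<forall>A B. A \<subseteq> B \<longrightarrow> h $ A \<le> h $ B) \<and>
         (\<forall>A B. h $ (A \<union> B) + h $ (A \<inter> B) \<le> h $ A + h $ B)}"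

text \<open>Fixing \<open>nat\<close> as the type of the outcomes and of the values of the variables is no loss of
  generality, since only finitely many values are taken; see \<open>entropicI\<close> below.  The random
  vector \<open>X\<^sub>A\<close> is represented by the restriction of \<open>i \<mapsto> X\<^sub>i\<close> to \<open>A\<close>.\<close>

definition subvector :: "('i \<Rightarrow> 'o \<Rightarrow> 'v) \<Rightarrow> 'i set \<Rightarrow> 'o \<Rightarrow> 'i \<Rightarrow> 'v" where
  "subvector X A \<omega> = (\<lambda>i\<in>A. X i \<omega>)"

definition shannon_entropy :: "'o measure \<Rightarrow> ('o \<Rightarrow> 'v) \<Rightarrow> real" where
  "shannon_entropy M Y = prob_space.entropy M 2 (count_space (Y ` space M)) Y"

definition entropic :: "setfun4 \<Rightarrow> bool" where
  "entropic h \<longleftrightarrow>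
     (\<exists>(M :: nat measure) (X :: 4 \<Rightarrow> nat \<Rightarrow> nat).
        prob_space M \<and> (\<forall>i. simple_function M (X i)) \<and>
        (\<forall>A. h $ A = shannon_entropy M (subvector X A)))"

definition rank_U34 :: setfun4 where
  "rank_U34 = (\<chi> A. real (min 3 (card A)))"

definition rank_U13_123 :: setfun4 where
  "rank_U13_123 = (\<chi> A. real (min 1 (card (A \<inter> {1, 2, 3}))))"

definition face_point :: "setfun4 \<Rightarrow> setfun4 \<Rightarrow> real \<Rightarrow> real \<Rightarrow> setfun4" where
  "face_point r1 r2 a b = a *\<^sub>R r1 + b *\<^sub>R r2"

definition spanned_face :: "setfun4 \<Rightarrow> setfun4 \<Rightarrow> setfun4 set" where
  "spanned_face r1 r2 = {face_point r1 r2 a b | a b. 0 \<le> a \<and> 0 \<le> b}"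

lemma shannon_entropy_eq_sum:
  assumes "prob_space M" "simple_function M Y"
  shows "shannon_entropy M Y =
    - (\<Sum>y\<in>Y ` space M. measure M (Y -` {y} \<inter> space M) * log 2 (measure M (Y -` {y} \<inter> space M)))"
proof -
  interpret prob_space M by fact
  interpret information_space M 2 by standard auto
  show ?thesis
    unfolding shannon_entropy_def
    by (rule entropy_simple_distributed, rule simple_distributedI) (use assms in auto)
qed

lemma simple_function_subvector:
  fixes X :: "4 \<Rightarrow> 'o \<Rightarrow> 'v"
  assumes "\<And>i. simple_function M (X i)"
  shows "simple_function M (subvector X A)"
proof -
  have sub: "subvector X A ` space M \<subseteq> (\<Pi>\<^sub>E i\<in>A. X i ` space M)"
    by (auto simp: subvector_def)
  have fin: "finite (\<Pi>\<^sub>E i\<in>A. X i ` space M)"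
    using assms by (intro finite_PiE) (auto simp: simple_function_def)
  have "subvector X A -` {y} \<inter> space M \<in> sets M" if "y \<in> subvector X A ` space M" for y
  proof -
    have ext: "y \<in> extensional A" using that by (auto simp: subvector_def)
    have "subvector X A -` {y} \<inter> space M = {\<omega> \<in> space M. \<forall>i\<in>A. X i \<omega> = y i}"
      using ext by (auto simp: subvector_def fun_eq_iff extensional_def restrict_def)
    also have "\<dots> \<in> sets M"
    proof (rule sets.sets_Collect_finite_All)
      fix i
      have "{\<omega> \<in> space M. X i \<omega> = y i} = X i -` {y i} \<inter> space M" by auto
      also have "\<dots> \<in> sets M" using assms[of i] by (rule simple_functionD(2))
      finally show "{\<omega> \<in> space M. X i \<omega> = y i} \<in> sets M" .
    qed auto
    finally show ?thesis .
  qed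
  then show ?thesis
    using finite_subset[OF sub fin] by (simp add: simple_function_def)
qed

lemma entropicI:
  fixes M :: "'o measure" and X :: "4 \<Rightarrow> 'o \<Rightarrow> 'v"
  assumes M: "prob_space M"
    and X: "\<And>i. simple_function M (X i)"
    and h: "\<And>A. h $ A = shannon_entropy M (subvector X A)"
  shows "entropic h"
proof -
  interpret prob_space M by fact
  define V where "V = subvector X UNIV"
  have sV: "simple_function M V" unfolding V_def by (rule simple_function_subvector) (rule X)
  then have finV: "finite (V ` space M)" by (simp add: simple_function_def)
  from finite_imp_inj_to_nat_seg[OF finV]
  obtain e :: "(4 \<Rightarrow> 'v) \<Rightarrow> nat" where e: "inj_on e (V ` space M)" by metis
  have finX: "finite (\<Union>i. X i ` space M)" using X by (simp add: simple_function_def)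
  from finite_imp_inj_to_nat_seg[OF finX]
  obtain c :: "'v \<Rightarrow> nat" where c: "inj_on c (\<Union>i. X i ` space M)" by metis
  define g where "g \<omega> = e (V \<omega>)" for \<omega>
  have sg: "simple_function M g"
    using simple_function_compose[OF sV, of e] by (simp add: g_def[abs_def] comp_def)
  have g_meas: "g \<in> measurable M (count_space (g ` space M))"
    using measurable_simple_function[OF sg] by (auto simp: measurable_def)
  define N where "N = distr M (count_space (g ` space M)) g"
  have spN: "space N = g ` space M" by (simp add: N_def)
  interpret N: prob_space N unfolding N_def using g_meas by (rule prob_space_distr)
  define Y where "Y i n = c (inv_into (V ` space M) e n i)" for i n
  have Yg: "Y i (g \<omega>) = c (X i \<omega>)" if "\<omega> \<in> space M" for i \<omega>
    using that e by (simp add: Y_def g_def V_def subvector_def)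
  have sY: "simple_function N (Y i)" for i
    unfolding simple_function_def
  proof (intro conjI ballI)
    show "finite (Y i ` space N)"
      unfolding spN using sg by (intro finite_imageI[of "g ` space M"]) (simp add: simple_function_def)
    show "Y i -` {y} \<inter> space N \<in> sets N" for y
      unfolding spN by (auto simp: N_def)
  qed
  have "h $ A = shannon_entropy N (subvector Y A)" for A
  proof -
    define C where "C y = (\<lambda>i\<in>A. c (y i))" for y :: "4 \<Rightarrow> 'v"
    have CY: "subvector Y A (g \<omega>) = C (subvector X A \<omega>)" if "\<omega> \<in> space M" for \<omega>
      using that by (auto simp: subvector_def C_def Yg fun_eq_iff)
    have injC: "inj_on C (subvector X A ` space M)"
    proof (rule inj_onI, clarify)
      fix \<omega> \<omega>' assume w: "\<omega> \<in> space M" "\<omega>' \<in> space M"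
        and eq: "C (subvector X A \<omega>) = C (subvector X A \<omega>')"
      have "X i \<omega> = X i \<omega>'" if "i \<in> A" for i
      proof -
        have "c (X i \<omega>) = c (X i \<omega>')"
          using fun_cong[OF eq, of i] that by (simp add: C_def subvector_def)
        then show ?thesis using c w by (auto simp: inj_on_def)
      qed
      then show "subvector X A \<omega> = subvector X A \<omega>'"
        by (auto simp: subvector_def fun_eq_iff)
    qed
    have im: "subvector Y A ` space N = C ` subvector X A ` space M"
      by (auto simp: spN CY image_image)
    have ms: "measure N (subvector Y A -` {C y} \<inter> space N) = measure M (subvector X A -` {y} \<inter> space M)"
      if "y \<in> subvector X A ` space M" for y
    proof -
      have "measure N (subvector Y A -` {C y} \<inter> space N)
          = measure M (g -` (subvector Y A -` {C y} \<inter> g ` space M) \<inter> space M)"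
        unfolding spN by (subst N_def, subst measure_distr) (use g_meas in auto)
      also have "g -` (subvector Y A -` {C y} \<inter> g ` space M) \<inter> space M = subvector X A -` {y} \<inter> space M"
      proof -
        have "subvector Y A (g \<omega>) = C y \<longleftrightarrow> subvector X A \<omega> = y" if "\<omega> \<in> space M" for \<omega>
          using that \<open>y \<in> subvector X A ` space M\<close> inj_on_eq_iff[OF injC, of "subvector X A \<omega>" y]
          by (simp add: CY)
        then show ?thesis by fastforce
      qed
      finally show ?thesis .
    qed
    show ?thesis
      unfolding h shannon_entropy_eq_sum[OF M simple_function_subvector[OF X]]
        shannon_entropy_eq_sum[OF N.prob_space_axioms simple_function_subvector[OF sY]]
        im sum.reindex[OF injC]
      by (simp add: ms cong: sum.cong)
  qed
  then show ?thesis
    unfolding entropic_def using N.prob_space_axioms sY by blast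
qed

lemma subset_4_cases:
  fixes A :: "4 set"
  shows "A \<in> {{}, {1}, {2}, {3}, {4}, {1,2}, {1,3}, {1,4}, {2,3}, {2,4}, {3,4},
              {1,2,3}, {1,2,4}, {1,3,4}, {2,3,4}, {1,2,3,4}}"
proof -
  have "A \<in> Pow {1,2,3,4}" by (simp flip: UNIV_4)
  then show ?thesis by (simp add: Pow_insert insert_commute)
qed

text \<open>The inequalities of the polymatroid cone that are tight on the face.\<close>

definition tight_pairs :: "(4 set \<times> 4 set) set" where
  "tight_pairs =
     {({1}, {4}), ({2}, {4}), ({3}, {4}),
      ({1,3}, {2,3}), ({1,2}, {2,3}), ({1,2}, {1,3}),
      ({1,2}, {1,4}), ({1,3}, {1,4}), ({2,3}, {2,4})}"

definition tight_U34_U13_123 :: "setfun4 \<Rightarrow> bool" where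
  "tight_U34_U13_123 h \<longleftrightarrow>
     (\<forall>(A, B) \<in> tight_pairs. h $ A + h $ B = h $ (A \<union> B) + h $ (A \<inter> B)) \<and>
     (\<forall>A \<in> {{1,2,3}, {1,2,4}, {1,3,4}, {2,3,4}}. h $ A = h $ UNIV)"

lemma neq4: "(1::4) \<noteq> 2" "(1::4) \<noteq> 3" "(1::4) \<noteq> 4" "(2::4) \<noteq> 3" "(2::4) \<noteq> 4" "(3::4) \<noteq> 4"
  by simp_all

lemma card_4_set:
  "card (A :: 4 set) = of_bool (1 \<in> A) + of_bool (2 \<in> A) + of_bool (3 \<in> A) + of_bool (4 \<in> A)"
proof -
  have "card A = (\<Sum>i\<in>UNIV. of_bool (i \<in> A))" by simp
  then show ?thesis by (simp only: sum_4)
qed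

lemma tight_of_tight_combination:
  assumes "tight_U34_U13_123 ((1 - u) *\<^sub>R p + u *\<^sub>R q)" "0 < u" "u < 1"
    and p: "p \<in> polymatroid_cone4" and q: "q \<in> polymatroid_cone4"
  shows "tight_U34_U13_123 p"
proof -
  have zero: "s = 0" if "(1 - u) * s + u * t = 0" "0 \<le> s" "0 \<le> t" for s t :: real
  proof -
    have "0 \<le> (1 - u) * s" "0 \<le> u * t" using that assms by auto
    with that have "(1 - u) * s = 0" by linarith
    then show ?thesis using assms by simp
  qed
  have sub: "p $ A + p $ B = p $ (A \<union> B) + p $ (A \<inter> B)"
    if "((1 - u) *\<^sub>R p + u *\<^sub>R q) $ A + ((1 - u) *\<^sub>R p + u *\<^sub>R q) $ B =
        ((1 - u) *\<^sub>R p + u *\<^sub>R q) $ (A \<union> B) + ((1 - u) *\<^sub>R p + u *\<^sub>R q) $ (A \<inter> B)" for A B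
  proof -
    have "p $ A + p $ B - p $ (A \<union> B) - p $ (A \<inter> B) = 0"
    proof (rule zero)
      show "(1 - u) * (p $ A + p $ B - p $ (A \<union> B) - p $ (A \<inter> B)) +
          u * (q $ A + q $ B - q $ (A \<union> B) - q $ (A \<inter> B)) = 0"
        using that by (simp add: algebra_simps)
      have "p $ (A \<union> B) + p $ (A \<inter> B) \<le> p $ A + p $ B"
        using p by (simp add: polymatroid_cone4_def)
      then show "0 \<le> p $ A + p $ B - p $ (A \<union> B) - p $ (A \<inter> B)" by linarith
      have "q $ (A \<union> B) + q $ (A \<inter> B) \<le> q $ A + q $ B"
        using q by (simp add: polymatroid_cone4_def)
      then show "0 \<le> q $ A + q $ B - q $ (A \<union> B) - q $ (A \<inter> B)" by linarith
    qed
    then show ?thesis by linarith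
  qed
  have mono: "p $ A = p $ UNIV"
    if "((1 - u) *\<^sub>R p + u *\<^sub>R q) $ A = ((1 - u) *\<^sub>R p + u *\<^sub>R q) $ UNIV" for A
  proof -
    have "p $ UNIV - p $ A = 0"
    proof (rule zero)
      show "(1 - u) * (p $ UNIV - p $ A) + u * (q $ UNIV - q $ A) = 0"
        using that by (simp add: algebra_simps)
      show "0 \<le> p $ UNIV - p $ A" "0 \<le> q $ UNIV - q $ A"
        using p q by (auto simp: polymatroid_cone4_def)
    qed
    then show ?thesis by linarith
  qed
  show ?thesis
    unfolding tight_U34_U13_123_def
  proof (intro conjI ballI, goal_cases)
    case (1 AB)
    with assms(1) have "case AB of (A, B) \<Rightarrow>
        ((1 - u) *\<^sub>R p + u *\<^sub>R q) $ A + ((1 - u) *\<^sub>R p + u *\<^sub>R q) $ B =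
        ((1 - u) *\<^sub>R p + u *\<^sub>R q) $ (A \<union> B) + ((1 - u) *\<^sub>R p + u *\<^sub>R q) $ (A \<inter> B)"
      unfolding tight_U34_U13_123_def by blast
    then show ?case using sub by (cases AB) simp
  next
    case (2 A)
    with assms(1) show ?case
      unfolding tight_U34_U13_123_def by (intro mono) blast
  qed
qed

lemma rank_U34_in_cone: "rank_U34 \<in> polymatroid_cone4"
proof -
  have "min 3 (card (A \<union> B)) + min 3 (card (A \<inter> B)) \<le> min 3 (card A) + min 3 (card B)"
    for A B :: "4 set"
  proof -
    have "card A + card B = card (A \<union> B) + card (A \<inter> B)" by (rule card_Un_Int) auto
    moreover have "card (A \<inter> B) \<le> card A" "card (A \<inter> B) \<le> card B"
      by (auto intro: card_mono)
    ultimately show ?thesis by (auto simp: min_def)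
  qed
  then show ?thesis
    by (auto simp: polymatroid_cone4_def rank_U34_def card_mono min.coboundedI2
        simp flip: of_nat_add of_nat_min)
qed

lemma rank_U13_123_in_cone: "rank_U13_123 \<in> polymatroid_cone4"
proof -
  have rank: "rank_U13_123 $ A = of_bool (A \<inter> {1, 2, 3} \<noteq> {})" for A
  proof (cases "A \<inter> {1, 2, 3} = {}")
    case False
    then have "0 < card (A \<inter> {1, 2, 3})" by (simp add: card_gt_0_iff)
    then have "min 1 (card (A \<inter> {1, 2, 3})) = 1" by linarith
    then show ?thesis using False by (simp add: rank_U13_123_def)
  qed (simp add: rank_U13_123_def)
  show ?thesis
    unfolding polymatroid_cone4_def mem_Collect_eq rank by (auto simp: of_bool_def)
qed

lemma spanned_face_U34_U13_123:
  "spanned_face rank_U34 rank_U13_123 face_of polymatroid_cone4"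
proof -
  let ?F = "spanned_face rank_U34 rank_U13_123"
  have cone: "a *\<^sub>R p + b *\<^sub>R q \<in> polymatroid_cone4"
    if "p \<in> polymatroid_cone4" "q \<in> polymatroid_cone4" "0 \<le> a" "0 \<le> b" for a b p q
  proof -
    have "a * p $ (A \<union> B) + b * q $ (A \<union> B) + (a * p $ (A \<inter> B) + b * q $ (A \<inter> B))
        \<le> a * p $ A + b * q $ A + (a * p $ B + b * q $ B)" for A B
    proof -
      have "a * (p $ (A \<union> B) + p $ (A \<inter> B)) \<le> a * (p $ A + p $ B)"
        "b * (q $ (A \<union> B) + q $ (A \<inter> B)) \<le> b * (q $ A + q $ B)"
        using that by (auto simp: polymatroid_cone4_def intro!: mult_left_mono)
      then show ?thesis by (simp add: algebra_simps)
    qed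
    then show ?thesis
      using that by (auto simp: polymatroid_cone4_def intro!: add_mono mult_left_mono)
  qed
  have F_cone: "?F \<subseteq> polymatroid_cone4"
    using cone[OF rank_U34_in_cone rank_U13_123_in_cone]
    by (auto simp: spanned_face_def face_point_def)
  have ranks_tight: "tight_U34_U13_123 rank_U34" "tight_U34_U13_123 rank_U13_123"
    unfolding tight_U34_U13_123_def tight_pairs_def
      rank_U34_def rank_U13_123_def vec_lambda_beta card_4_set
    by (intro conjI ballI; elim insertE emptyE; hypsubst;
        simp only: prod.case Un_iff Int_iff insert_iff empty_iff UNIV_I neq4 neq4[symmetric]
          simp_thms of_bool_eq; simp)+
  have F_tight: "tight_U34_U13_123 h" if hF: "h \<in> ?F" for h
  proof -
    obtain a b where h: "h = a *\<^sub>R rank_U34 + b *\<^sub>R rank_U13_123"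
      using hF unfolding spanned_face_def face_point_def by blast
    show ?thesis
      unfolding tight_U34_U13_123_def
    proof (intro conjI ballI, goal_cases)
      case (1 AB)
      obtain A B where AB: "AB = (A, B)" by (cases AB)
      have "rank_U34 $ A + rank_U34 $ B = rank_U34 $ (A \<union> B) + rank_U34 $ (A \<inter> B)"
        "rank_U13_123 $ A + rank_U13_123 $ B = rank_U13_123 $ (A \<union> B) + rank_U13_123 $ (A \<inter> B)"
        using ranks_tight 1 unfolding AB tight_U34_U13_123_def by blast+
      then have "a * (rank_U34 $ A + rank_U34 $ B) + b * (rank_U13_123 $ A + rank_U13_123 $ B) =
          a * (rank_U34 $ (A \<union> B) + rank_U34 $ (A \<inter> B)) +
          b * (rank_U13_123 $ (A \<union> B) + rank_U13_123 $ (A \<inter> B))"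
        by simp
      then show ?case by (simp add: AB h algebra_simps)
    next
      case (2 A)
      then have "rank_U34 $ A = rank_U34 $ UNIV" "rank_U13_123 $ A = rank_U13_123 $ UNIV"
        using ranks_tight unfolding tight_U34_U13_123_def by blast+
      then show ?case by (simp add: h)
    qed
  qed
  have tight_F: "h \<in> ?F" if h: "h \<in> polymatroid_cone4" and t: "tight_U34_U13_123 h" for h
  proof -
    define a where "a = h $ {4}"
    define b where "b = h $ {1} - h $ {4}"
    have h0: "h $ {} = 0" using h by (simp add: polymatroid_cone4_def)
    have "h $ {} \<le> h $ {4}" using h unfolding polymatroid_cone4_def by blast
    then have a: "0 \<le> a" by (simp add: a_def h0)
    have sub: "h $ ({1, 4} \<union> {2, 4}) + h $ ({1, 4} \<inter> {2, 4}) \<le> h $ {1, 4} + h $ {2, 4}"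
      using h unfolding polymatroid_cone4_def by blast
    have T: "h $ A + h $ B = h $ C + h $ D" if "(A, B) \<in> tight_pairs" "A \<union> B = C" "A \<inter> B = D" for A B C D
      using t that unfolding tight_U34_U13_123_def by blast
    have eqs: "h $ {1} + h $ {4} = h $ {1,4} + h $ {}"
      "h $ {2} + h $ {4} = h $ {2,4} + h $ {}"
      "h $ {3} + h $ {4} = h $ {3,4} + h $ {}"
      "h $ {1,3} + h $ {2,3} = h $ {1,2,3} + h $ {3}"
      "h $ {1,2} + h $ {2,3} = h $ {1,2,3} + h $ {2}"
      "h $ {1,2} + h $ {1,3} = h $ {1,2,3} + h $ {1}"
      "h $ {1,2} + h $ {1,4} = h $ {1,2,4} + h $ {1}"
      "h $ {1,3} + h $ {1,4} = h $ {1,3,4} + h $ {1}"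
      "h $ {2,3} + h $ {2,4} = h $ {2,3,4} + h $ {2}"
      by (rule T; force simp: tight_pairs_def)+
    have top: "h $ {1,2,3} = h $ {1,2,3,4}" "h $ {1,2,4} = h $ {1,2,3,4}"
      "h $ {1,3,4} = h $ {1,2,3,4}" "h $ {2,3,4} = h $ {1,2,3,4}"
      using t unfolding tight_U34_U13_123_def by (simp_all add: UNIV_4)
    have "{1, 4} \<union> {2, 4} = {1,2,4::4}" "{1, 4} \<inter> {2, 4} = {4::4}" by auto
    then have sub': "h $ {1,2,4} + h $ {4} \<le> h $ {1, 4} + h $ {2, 4}"
      using sub by simp
    have p1: "h $ {1,2} = h $ {1,2,3,4} - h $ {4}" "h $ {1,3} = h $ {1,2,3,4} - h $ {4}"
      "h $ {2,3} = h $ {1,2,3,4} - h $ {4}"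
      using eqs(1,2,7,8,9) top h0 by linarith+
    have p2: "h $ {1,2,3,4} = h $ {1} + 2 * h $ {4}" using eqs(6) p1 top by linarith
    have p3: "h $ {2} = h $ {1}" "h $ {3} = h $ {1}" using eqs(4,5,6) p1 by linarith+
    have vals: "h $ {1} = a + b" "h $ {2} = a + b" "h $ {3} = a + b" "h $ {4} = a"
      using p3 by (simp_all add: a_def b_def)
    have vals4: "h $ {1,2,3,4} = 3 * a + b" using p2 vals by linarith
    have vals2: "h $ {1,2} = 2 * a + b" "h $ {1,3} = 2 * a + b" "h $ {2,3} = 2 * a + b"
      using p1 vals(4) vals4 by linarith+
    have vals3: "h $ {1,4} = 2 * a + b" "h $ {2,4} = 2 * a + b" "h $ {3,4} = 2 * a + b"
      using eqs(1,2,3) vals h0 by linarith+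
    note vals = vals vals2 vals3 vals4 top[unfolded vals4]
    have b: "0 \<le> b" using sub' vals by linarith
    have "h $ A = face_point rank_U34 rank_U13_123 a b $ A" for A
      using subset_4_cases[of A] unfolding insert_iff empty_iff
      by (elim disjE) (simp_all add: vals h0 face_point_def rank_U34_def rank_U13_123_def card_4_set)
    then have "h = face_point rank_U34 rank_U13_123 a b" by (simp add: vec_eq_iff)
    then show ?thesis using a b by (auto simp: spanned_face_def)
  qed
  have F: "p \<in> ?F" "q \<in> ?F"
    if pq: "p \<in> polymatroid_cone4" "q \<in> polymatroid_cone4" and xF: "x \<in> ?F" and x: "x \<in> open_segment p q" for p q x
  proof -
    obtain u where u: "0 < u" "u < 1" "x = (1 - u) *\<^sub>R p + u *\<^sub>R q"
      using x by (auto simp: in_segment)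
    have t: "tight_U34_U13_123 x" by (rule F_tight) fact
    show "p \<in> ?F"
      by (rule tight_F[OF pq(1)], rule tight_of_tight_combination[of u p q]) (use t u pq in auto)
    show "q \<in> ?F"
      by (rule tight_F[OF pq(2)], rule tight_of_tight_combination[of "1 - u" q p])
        (use t u pq in \<open>auto simp: add.commute\<close>)
  qed
  have "convex ?F"
  proof (rule convexI)
    fix x y :: setfun4 and u v :: real
    assume "x \<in> ?F" "y \<in> ?F" and uv: "0 \<le> u" "0 \<le> v"
    then obtain a b a' b' where "0 \<le> a" "0 \<le> b" "0 \<le> a'" "0 \<le> b'"
      "x = a *\<^sub>R rank_U34 + b *\<^sub>R rank_U13_123" "y = a' *\<^sub>R rank_U34 + b' *\<^sub>R rank_U13_123"
      by (auto simp: spanned_face_def face_point_def)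
    then have "u *\<^sub>R x + v *\<^sub>R y = face_point rank_U34 rank_U13_123 (u * a + v * a') (u * b + v * b')"
      and "0 \<le> u * a + v * a'" "0 \<le> u * b + v * b'"
      using uv by (simp_all add: face_point_def algebra_simps)
    then show "u *\<^sub>R x + v *\<^sub>R y \<in> ?F" unfolding spanned_face_def by blast
  qed
  then show ?thesis
    using F_cone F unfolding face_of_def by blast
qed

end

theory Submission
  imports Defs "HOL-Real_Asymp.Real_Asymp"
begin

text \<open>Suppose \<open>(a, b)\<close> is the entropy vector of \<open>(x, y, z, w)\<close>, the variable \<open>w\<close> being \<open>X\<^sub>4\<close>.
  Then \<open>w\<close> is independent of \<open>(x, y)\<close> and of \<open>(x, z)\<close>, any three variables determine the fourth,
  and \<open>y\<close>, \<open>z\<close> are conditionally independent given \<open>x\<close>.  Hence on the support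
  \<open>P(x, y, z) = P(x, y) P(w) = P(x, z) P(w)\<close> and \<open>P(x, y, z) P(x) = P(x, y) P(x, z)\<close>, so
  \<open>P(y | x) = P(z | x) = P(w)\<close>.  For a fixed \<open>x\<close> all pairs \<open>(y, z)\<close> of possible values occur
  together, so these probabilities do not depend on \<open>y\<close>, \<open>z\<close>; as \<open>w\<close> is independent of \<open>x\<close>,
  it is uniform on its support, whose size is the required \<open>v\<close>.

  Conversely, take \<open>(z\<^sub>1, z\<^sub>2, z\<^sub>3, z\<^sub>4)\<close> uniform on the zero-sum vectors over \<open>\<int>/v\<close> and an independent \<open>J\<close>
  of entropy \<open>b\<close>, and put \<open>X\<^sub>i = (J, z\<^sub>i)\<close> for \<open>i \<le> 3\<close> and \<open>X\<^sub>4 = z\<^sub>4\<close>.\<close>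

section \<open>Entropy through masses of fibers\<close>

definition fiber_mass :: "('s \<Rightarrow> real) \<Rightarrow> 's set \<Rightarrow> ('s \<Rightarrow> 'y) \<Rightarrow> 's \<Rightarrow> real" where
  "fiber_mass p T g s = (\<Sum>t\<in>{t\<in>T. g t = g s}. p t)"

text \<open>This is the Shannon entropy of \<open>g\<close> under the weights \<open>p\<close>, with
  the sum over values regrouped as a sum over points. Entropies of functions with different
  codomains thereby become sums over the same \<open>T\<close> and can be compared term by
  term.\<close>

definition fiber_entropy :: "('s \<Rightarrow> real) \<Rightarrow> 's set \<Rightarrow> ('s \<Rightarrow> 'y) \<Rightarrow> real" where
  "fiber_entropy p T g = - (\<Sum>s\<in>T. p s * log 2 (fiber_mass p T g s))"

text \<open>Only the partition into fibers matters, so a tuple may be exchanged for a restriction to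
  its coordinates, and a dummy component \<open>()\<close> may be dropped.\<close>

lemma fiber_mass_kernel:
  "(\<And>s t. g s = g t \<longleftrightarrow> g' s = g' t) \<Longrightarrow> fiber_mass p T g = fiber_mass p T g'"
  by (simp add: fiber_mass_def fun_eq_iff)

lemma fiber_mass_pos:
  assumes "finite T" "\<And>s. s \<in> T \<Longrightarrow> 0 \<le> p s" "s \<in> T" "0 < p s"
  shows "0 < fiber_mass p T g s"
  unfolding fiber_mass_def by (rule sum_pos2[where i = s]) (use assms in auto)

lemma fiber_mass_cong: "g s = g s' \<Longrightarrow> fiber_mass p T g s = fiber_mass p T g s'"
  by (simp add: fiber_mass_def)

lemma sum_fibers:
  fixes f :: "'y \<Rightarrow> real"
  assumes "finite T" "finite G" "g ` T \<subseteq> G"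
  shows "(\<Sum>y\<in>G. (\<Sum>t\<in>{t\<in>T. g t = y}. p t) * f y) = (\<Sum>s\<in>T. p s * f (g s))"
proof -
  have "(\<Sum>y\<in>G. (\<Sum>t\<in>{t\<in>T. g t = y}. p t) * f y) =
      (\<Sum>y\<in>G. \<Sum>t\<in>{t\<in>T. g t = y}. p t * f (g t))"
    by (intro sum.cong refl) (simp add: sum_distrib_right)
  also have "\<dots> = (\<Sum>s\<in>T. p s * f (g s))"
    using assms by (rule sum.group)
  finally show ?thesis .
qed

text \<open>The event \<open>Y = y\<close> is the disjoint union of the events \<open>V = t\<close>
  with \<open>g t = y\<close>, so the law of \<open>Y\<close> is obtained from that of
  \<open>V\<close> by summing over fibers of \<open>g\<close>.\<close>

lemma shannon_entropy_eq_fiber_entropy: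
  assumes M: "prob_space M" and V: "simple_function M V"
    and Y: "\<And>\<omega>. \<omega> \<in> space M \<Longrightarrow> Y \<omega> = g (V \<omega>)"
    and p: "\<And>s. s \<in> V ` space M \<Longrightarrow> p s = measure M (V -` {s} \<inter> space M)"
  shows "shannon_entropy M Y = fiber_entropy p (V ` space M) g"
proof -
  interpret prob_space M by fact
  let ?T = "V ` space M"
  have fin: "finite ?T" using V by (simp add: simple_function_def)
  have sY: "simple_function M Y"
    using simple_function_compose[OF V, of g] Y by (simp cong: simple_function_cong)
  have im: "Y ` space M = g ` ?T" using Y by (auto simp: image_image)
  have ms: "measure M (Y -` {y} \<inter> space M) = (\<Sum>t\<in>{t\<in>?T. g t = y}. p t)" for y
  proof -
    have "Y -` {y} \<inter> space M = (\<Union>t\<in>{t\<in>?T. g t = y}. V -` {t} \<inter> space M)"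
      using Y by auto
    also have "measure M \<dots> = (\<Sum>t\<in>{t\<in>?T. g t = y}. measure M (V -` {t} \<inter> space M))"
      using fin V by (intro finite_measure_finite_Union)
        (auto simp: disjoint_family_on_def intro: simple_functionD)
    finally show ?thesis using p by simp
  qed
  have "shannon_entropy M Y =
      - (\<Sum>y\<in>g ` ?T. (\<Sum>t\<in>{t\<in>?T. g t = y}. p t) * log 2 (\<Sum>t\<in>{t\<in>?T. g t = y}. p t))"
    unfolding shannon_entropy_eq_sum[OF M sY] im ms ..
  also have "\<dots> = fiber_entropy p ?T g"
    unfolding fiber_entropy_def fiber_mass_def using fin by (subst sum_fibers) auto
  finally show ?thesis .
qed

section \<open>Equality cases of entropy inequalities\<close>

text \<open>Each defect \<open>d s\<close> is nonnegative by \<open>ln x \<le> x - 1\<close>, with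
  equality only where \<open>p s = q s\<close>. The hypotheses make the defects sum to at most 0, so
  all of them vanish.\<close>

lemma gibbs_equality:
  fixes p q :: "'s \<Rightarrow> real"
  assumes fin: "finite S"
    and nn: "\<And>s. s \<in> S \<Longrightarrow> 0 \<le> p s" "\<And>s. s \<in> S \<Longrightarrow> 0 \<le> q s"
    and ac: "\<And>s. s \<in> S \<Longrightarrow> 0 < p s \<Longrightarrow> 0 < q s"
    and le: "sum q S \<le> sum p S"
    and eq: "(\<Sum>s\<in>S. p s * log 2 (p s)) = (\<Sum>s\<in>S. p s * log 2 (q s))"
    and s: "s \<in> S"
  shows "p s = q s"
proof -
  define d where "d s = q s - p s - p s * (ln (q s) - ln (p s))" for s
  have d: "0 \<le> d s \<and> (d s = 0 \<longrightarrow> p s = q s)" if "s \<in> S" for s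
  proof (cases "p s = 0")
    case True
    then show ?thesis using nn[OF that] by (simp add: d_def)
  next
    case False
    then have pos: "0 < p s" "0 < q s" using nn[OF that] ac[OF that] by auto
    have dd: "d s = p s * (q s / p s - 1 - ln (q s / p s))"
      using pos by (simp add: d_def ln_div field_simps)
    have "ln (q s / p s) \<le> q s / p s - 1" using pos by (intro ln_le_minus_one) simp
    moreover have "q s / p s = 1" if "ln (q s / p s) = q s / p s - 1"
      using pos that by (intro ln_eq_minus_one) simp_all
    ultimately show ?thesis using pos unfolding dd by (auto intro: mult_nonneg_nonneg)
  qed
  have "(\<Sum>s\<in>S. p s * ln (p s)) = (\<Sum>s\<in>S. p s * ln (q s))"
    using eq by (simp add: log_def flip: sum_divide_distrib)
  then have "sum d S = sum q S - sum p S"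
    by (simp add: d_def sum_subtractf right_diff_distrib)
  then have "sum d S \<le> 0" using le by simp
  then have "sum d S = 0" using d by (intro antisym sum_nonneg) auto
  then have "d s = 0" using d fin s by (simp add: sum_nonneg_eq_0_iff)
  then show ?thesis using d s by blast
qed

text \<open>The entropy equation says that the conditional mutual information of \<open>Y\<close>
  and \<open>Z\<close> given \<open>X\<close> is 0. It is the equality case of Gibbs' inequality
  between the joint law \<open>P\<close> and the law \<open>Q\<close> that makes \<open>Y\<close>
  and \<open>Z\<close> independent given \<open>X\<close>. Two points \<open>s\<close> and
  \<open>t\<close> are used because the combination of \<open>Y s\<close> with \<open>Z t\<close> is
  not known in advance to occur.\<close>

lemma conditional_independence_of_entropies:
  fixes p :: "'s \<Rightarrow> real"
  assumes fin: "finite T" and p: "\<And>s. s \<in> T \<Longrightarrow> 0 \<le> p s"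
    and eq: "fiber_entropy p T (\<lambda>s. (X s, Y s)) + fiber_entropy p T (\<lambda>s. (X s, Z s)) =
        fiber_entropy p T (\<lambda>s. (X s, Y s, Z s)) + fiber_entropy p T X"
    and st: "s \<in> T" "t \<in> T" "X s = X t"
  shows "(\<Sum>r\<in>{r\<in>T. X r = X s \<and> Y r = Y s \<and> Z r = Z t}. p r) * fiber_mass p T X s =
    fiber_mass p T (\<lambda>s. (X s, Y s)) s * fiber_mass p T (\<lambda>s. (X s, Z s)) t"
proof -
  \<comment> \<open>The full product is needed: \<open>Q\<close> may charge triples outside the
    image of \<open>T\<close>.\<close>
  define S where "S = X ` T \<times> Y ` T \<times> Z ` T"
  define mx where "mx x = (\<Sum>r\<in>{r\<in>T. X r = x}. p r)" for x
  define mxy where "mxy x y = (\<Sum>r\<in>{r\<in>T. (X r, Y r) = (x, y)}. p r)" for x y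
  define mxz where "mxz x z = (\<Sum>r\<in>{r\<in>T. (X r, Z r) = (x, z)}. p r)" for x z
  define P where "P u = (\<Sum>r\<in>{r\<in>T. (X r, Y r, Z r) = u}. p r)" for u
  define Q where "Q = (\<lambda>(x, y, z). mxy x y * mxz x z / mx x)"
  have finS: "finite S" using fin by (simp add: S_def)
  have nn: "0 \<le> mx x" "0 \<le> mxy x y" "0 \<le> mxz x z" "0 \<le> P u" for x y z u
    unfolding mx_def mxy_def mxz_def P_def using p by (auto intro!: sum_nonneg)
  have le: "P (x, y, z) \<le> mxy x y" "P (x, y, z) \<le> mxz x z" "P (x, y, z) \<le> mx x" for x y z
    unfolding mx_def mxy_def mxz_def P_def using p fin by (auto intro!: sum_mono2)
  have sums: "(\<Sum>y\<in>Y ` T. mxy x y) = mx x" "(\<Sum>z\<in>Z ` T. mxz x z) = mx x" for x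
  proof -
    have g: "(\<Sum>y\<in>W ` T. \<Sum>r\<in>{r\<in>{r\<in>T. X r = x}. W r = y}. p r) = mx x" for W :: "'s \<Rightarrow> 'w"
      unfolding mx_def using fin by (intro sum.group) auto
    have "mxy x = (\<lambda>y. \<Sum>r\<in>{r\<in>{r\<in>T. X r = x}. Y r = y}. p r)"
      "mxz x = (\<lambda>z. \<Sum>r\<in>{r\<in>{r\<in>T. X r = x}. Z r = z}. p r)"
      by (auto simp: mxy_def mxz_def fun_eq_iff intro!: sum.cong)
    then show "(\<Sum>y\<in>Y ` T. mxy x y) = mx x" "(\<Sum>z\<in>Z ` T. mxz x z) = mx x"
      using g by simp_all
  qed
  have img: "(\<lambda>r. (X r, Y r, Z r)) ` T \<subseteq> S" by (auto simp: S_def)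
  note E = sum_fibers[OF fin finS img, of p, folded P_def]
  have PQ: "P u = Q u" if "u \<in> S" for u
  proof (rule gibbs_equality[OF finS _ _ _ _ _ that])
    fix u show "0 \<le> P u" "0 \<le> Q u" using nn by (auto simp: Q_def split: prod.split)
  next
    fix u assume "0 < P u"
    obtain x y z where u: "u = (x, y, z)" by (cases u)
    have "0 < mxy x y" "0 < mxz x z" "0 < mx x"
      using le[of x y z] \<open>0 < P u\<close> unfolding u by linarith+
    then show "0 < Q u" by (simp add: u Q_def)
  next
    have "sum Q S = (\<Sum>x\<in>X ` T. (\<Sum>y\<in>Y ` T. mxy x y) * (\<Sum>z\<in>Z ` T. mxz x z) / mx x)"
      unfolding S_def Q_def
      by (simp add: sum.cartesian_product[symmetric] sum_product sum_divide_distrib)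
    also have "\<dots> = (\<Sum>x\<in>X ` T. mx x)" by (simp add: sums)
    also have "\<dots> = (\<Sum>s\<in>T. p s)"
      unfolding mx_def using fin by (intro sum.group) auto
    also have "\<dots> = sum P S" using E[of "\<lambda>_. 1"] by simp
    finally show "sum Q S \<le> sum P S" by simp
  next
    have "(\<Sum>u\<in>S. P u * log 2 (Q u)) = (\<Sum>u\<in>S. P u *
        (case u of (x, y, z) \<Rightarrow> log 2 (mxy x y) + log 2 (mxz x z) - log 2 (mx x)))"
    proof (intro sum.cong refl)
      fix u :: "'a \<times> 'b \<times> 'c"
      obtain x y z where u: "u = (x, y, z)" by (cases u)
      have "log 2 (Q u) = log 2 (mxy x y) + log 2 (mxz x z) - log 2 (mx x)" if "P u \<noteq> 0"
      proof -
        have "0 < P u" using that nn(4)[of u] by simp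
        then have "0 < mxy x y" "0 < mxz x z" "0 < mx x"
          using le[of x y z] unfolding u by linarith+
        then show ?thesis by (simp add: u Q_def log_mult log_divide)
      qed
      then show "P u * log 2 (Q u) =
        P u * (case u of (x, y, z) \<Rightarrow> log 2 (mxy x y) + log 2 (mxz x z) - log 2 (mx x))"
        unfolding u by auto
    qed
    also have "\<dots> = (\<Sum>s\<in>T. p s *
        (log 2 (mxy (X s) (Y s)) + log 2 (mxz (X s) (Z s)) - log 2 (mx (X s))))"
      by (simp add: E)
    also have "\<dots> = (\<Sum>s\<in>T. p s * log 2 (P (X s, Y s, Z s)))"
      using eq unfolding mxy_def mxz_def mx_def P_def fiber_mass_def fiber_entropy_def
      by (simp add: algebra_simps sum.distrib sum_subtractf)
    finally show "(\<Sum>u\<in>S. P u * log 2 (P u)) = (\<Sum>u\<in>S. P u * log 2 (Q u))" by (simp add: E)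
  qed
  have "(X s, Y s, Z t) \<in> S" using st by (auto simp: S_def)
  then have "P (X s, Y s, Z t) = mxy (X s) (Y s) * mxz (X s) (Z t) / mx (X s)"
    using PQ by (force simp: Q_def)
  \<comment> \<open>Since division by 0 gives 0, clearing the denominator requires the numerator to
    vanish with it.\<close>
  moreover have "mxy (X s) (Y s) = 0" if "mx (X s) = 0"
  proof -
    have "mxy (X s) (Y s) \<le> mx (X s)"
      unfolding mx_def mxy_def using p fin by (auto intro!: sum_mono2)
    then show ?thesis using that nn(2) by (simp add: order_antisym)
  qed
  ultimately have "P (X s, Y s, Z t) * mx (X s) = mxy (X s) (Y s) * mxz (X s) (Z t)"
    by auto
  then show ?thesis
    using st by (simp add: P_def mx_def mxy_def mxz_def fiber_mass_def)
qed

text \<open>Fibers of \<open>f\<close> lie inside fibers of \<open>g\<close>, so the two entropy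
  sums are ordered termwise; equal totals force equal terms. In other words, if \<open>f\<close>
  carries no more entropy than \<open>g\<close>, then \<open>g\<close> determines \<open>f\<close>
  up to mass 0.\<close>

lemma fiber_mass_eq_of_entropies:
  fixes p :: "'s \<Rightarrow> real"
  assumes fin: "finite T" and p: "\<And>s. s \<in> T \<Longrightarrow> 0 \<le> p s"
    and fg: "\<And>s t. f s = f t \<Longrightarrow> g s = g t"
    and eq: "fiber_entropy p T f = fiber_entropy p T g"
    and s: "s \<in> T" "0 < p s"
  shows "fiber_mass p T f s = fiber_mass p T g s"
proof -
  have pos: "0 < fiber_mass p T f t" if "t \<in> T" "0 < p t" for t
    by (rule fiber_mass_pos) (use fin p that in auto)
  have eq': "(\<Sum>s\<in>T. p s * log 2 (fiber_mass p T f s)) = (\<Sum>s\<in>T. p s * log 2 (fiber_mass p T g s))"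
    using eq by (simp add: fiber_entropy_def)
  have le: "fiber_mass p T f t \<le> fiber_mass p T g t" for t
    unfolding fiber_mass_def using fin by (intro sum_mono2) (auto intro: p fg)
  have "p s * log 2 (fiber_mass p T f s) = p s * log 2 (fiber_mass p T g s)"
  proof (rule sum_mono_inv[OF eq' _ s(1) fin])
    fix t assume t: "t \<in> T"
    show "p t * log 2 (fiber_mass p T f t) \<le> p t * log 2 (fiber_mass p T g t)"
    proof (cases "p t = 0")
      case False
      then have "0 < p t" using p[OF t] by simp
      then show ?thesis using pos[OF t] le[of t] by (intro mult_left_mono) auto
    qed simp
  qed
  then have "log 2 (fiber_mass p T f s) = log 2 (fiber_mass p T g s)" using s by simp
  then show ?thesis using pos[OF s] le[of s] by (simp add: log_inj[of 2, THEN inj_onD])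
qed

text \<open>This is conditional independence given the constant variable \<open>()\<close>, whose
  only fiber has mass 1.\<close>

lemma independence_of_entropies:
  fixes p :: "'s \<Rightarrow> real"
  assumes fin: "finite T" and p: "\<And>s. s \<in> T \<Longrightarrow> 0 \<le> p s" and one: "sum p T = 1"
    and eq: "fiber_entropy p T Y + fiber_entropy p T Z = fiber_entropy p T (\<lambda>s. (Y s, Z s))"
    and st: "s \<in> T" "t \<in> T"
  shows "(\<Sum>r\<in>{r\<in>T. Y r = Y s \<and> Z r = Z t}. p r) = fiber_mass p T Y s * fiber_mass p T Z t"
proof -
  have unit: "fiber_mass p T (\<lambda>s. ((), g s)) = fiber_mass p T g" for g :: "'s \<Rightarrow> 'w"
    by (rule fiber_mass_kernel) simp
  have triv: "fiber_mass p T (\<lambda>s. ()) s = 1" for s by (simp add: fiber_mass_def one)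
  have "fiber_entropy p T (\<lambda>s. ((), Y s)) + fiber_entropy p T (\<lambda>s. ((), Z s)) =
      fiber_entropy p T (\<lambda>s. ((), Y s, Z s)) + fiber_entropy p T (\<lambda>s. ())"
    using eq by (simp add: fiber_entropy_def unit triv)
  from conditional_independence_of_entropies[OF fin p this st] show ?thesis
    by (simp add: unit triv)
qed

section \<open>Uniformity of the fourth variable\<close>

lemma entropy_eq_log_card_of_tight:
  fixes p :: "'s \<Rightarrow> real" and x y z w :: "'s \<Rightarrow> 'v"
  assumes fin: "finite T" and p: "\<And>s. s \<in> T \<Longrightarrow> 0 \<le> p s" and one: "sum p T = 1"
    and yz_given_x: "fiber_entropy p T (\<lambda>s. (x s, y s)) + fiber_entropy p T (\<lambda>s. (x s, z s)) =
        fiber_entropy p T (\<lambda>s. (x s, y s, z s)) + fiber_entropy p T x"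
    and w_xy: "fiber_entropy p T w + fiber_entropy p T (\<lambda>s. (x s, y s)) =
        fiber_entropy p T (\<lambda>s. (w s, x s, y s))"
    and w_xz: "fiber_entropy p T w + fiber_entropy p T (\<lambda>s. (x s, z s)) =
        fiber_entropy p T (\<lambda>s. (w s, x s, z s))"
    and w_x: "fiber_entropy p T w + fiber_entropy p T x = fiber_entropy p T (\<lambda>s. (w s, x s))"
    and det: "fiber_entropy p T (\<lambda>s. (w s, x s, y s, z s)) = fiber_entropy p T (\<lambda>s. (x s, y s, z s))"
      "fiber_entropy p T (\<lambda>s. (w s, x s, y s, z s)) = fiber_entropy p T (\<lambda>s. (w s, x s, y s))"
      "fiber_entropy p T (\<lambda>s. (w s, x s, y s, z s)) = fiber_entropy p T (\<lambda>s. (w s, x s, z s))"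
  shows "\<exists>v::nat. 1 \<le> v \<and> fiber_entropy p T w = log 2 (real v)"
proof -
  \<comment> \<open>\<open>T\<close> may contain points of mass 0, where the equalities of fiber
    masses can fail.\<close>
  define S where "S = {s\<in>T. 0 < p s}"
  let ?m = "\<lambda>g. fiber_mass p T g"
  let ?xy = "\<lambda>s. (x s, y s)" and ?xz = "\<lambda>s. (x s, z s)"
  have pos: "0 < fiber_mass p T g t" if "t \<in> T" "0 < p t" for t and g :: "'s \<Rightarrow> 'g"
    by (rule fiber_mass_pos) (use fin p that in auto)
  have S: "s \<in> T" "0 < p s" if "s \<in> S" for s using that by (auto simp: S_def)
  have wit: "\<exists>r\<in>S. E r" if "0 < (\<Sum>r\<in>{r\<in>T. E r}. p r)" for E
  proof (rule ccontr)
    assume "\<not> (\<exists>r\<in>S. E r)"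
    then have "(\<Sum>r\<in>{r\<in>T. E r}. p r) \<le> 0"
      by (intro sum_nonpos) (auto simp: S_def not_less)
    then show False using that by simp
  qed
  \<comment> \<open>This is P(y | x) = P(z | x) = P(w) with the denominators cleared.\<close>
  have fibers: "?m ?xy s = ?m ?xz s \<and> ?m w s * ?m x s = ?m ?xz s" if "s \<in> S" for s
  proof -
    note s = S[OF that]
    have "?m (\<lambda>s. (w s, x s, y s, z s)) s = ?m (\<lambda>s. (x s, y s, z s)) s"
      "?m (\<lambda>s. (w s, x s, y s, z s)) s = ?m (\<lambda>s. (w s, x s, y s)) s"
      "?m (\<lambda>s. (w s, x s, y s, z s)) s = ?m (\<lambda>s. (w s, x s, z s)) s"
      by (rule fiber_mass_eq_of_entropies[OF fin p]; use det s in auto)+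
    moreover have "?m (\<lambda>s. (w s, x s, y s)) s = ?m w s * ?m ?xy s"
      using independence_of_entropies[OF fin p one w_xy s(1) s(1)]
      by (simp add: fiber_mass_def)
    moreover have "?m (\<lambda>s. (w s, x s, z s)) s = ?m w s * ?m ?xz s"
      using independence_of_entropies[OF fin p one w_xz s(1) s(1)]
      by (simp add: fiber_mass_def)
    moreover have "?m (\<lambda>s. (x s, y s, z s)) s * ?m x s = ?m ?xy s * ?m ?xz s"
      using conditional_independence_of_entropies[OF fin p yz_given_x s(1) s(1)]
      by (simp add: fiber_mass_def)
    moreover have "0 < ?m w s" "0 < ?m ?xy s" "0 < ?m ?xz s" "0 < ?m x s" using pos s by blast+
    ultimately have q: "0 < ?m w s" "0 < ?m ?xy s"
      and eqs: "?m w s * ?m ?xy s = ?m w s * ?m ?xz s"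
        "(?m w s * ?m ?xy s) * ?m x s = ?m ?xy s * ?m ?xz s"
      by simp_all
    have "?m ?xy s * (?m w s * ?m x s) = ?m ?xy s * ?m ?xz s"
      using eqs(2) by (simp only: ac_simps)
    then show ?thesis using q eqs(1) by simp
  qed
  \<comment> \<open>A point \<open>r\<close> with the \<open>y\<close>-value of \<open>s\<close> and
    the \<open>z\<close>-value of \<open>t\<close> links the two: its \<open>(x, y)\<close> mass is
    that of \<open>s\<close>, its \<open>(x, z)\<close> mass is that of \<open>t\<close>, and
    \<open>fibers\<close> equates them.\<close>
  have same_x: "?m w s = ?m w t" if "s \<in> S" "t \<in> S" "x s = x t" for s t
  proof -
    have "0 < ?m ?xy s * ?m ?xz t" using that by (intro mult_pos_pos pos S)
    also have "\<dots> = (\<Sum>r\<in>{r\<in>T. x r = x s \<and> y r = y s \<and> z r = z t}. p r) * ?m x s"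
      using conditional_independence_of_entropies[OF fin p yz_given_x] S that by simp
    finally have "0 < (\<Sum>r\<in>{r\<in>T. x r = x s \<and> y r = y s \<and> z r = z t}. p r)"
      using pos[of s x] S[OF that(1)] by (simp add: zero_less_mult_iff)
    from wit[OF this] obtain r where r: "r \<in> S" "x r = x s" "y r = y s" "z r = z t" by blast
    have "?m ?xz s = ?m ?xy s" using fibers that by simp
    also have "\<dots> = ?m ?xy r" using r by (intro fiber_mass_cong) simp
    also have "\<dots> = ?m ?xz r" using fibers r by simp
    also have "\<dots> = ?m ?xz t" using r that by (intro fiber_mass_cong) simp
    finally have "?m w s * ?m x s = ?m w t * ?m x t" using fibers that by simp
    moreover have "?m x s = ?m x t" using that by (intro fiber_mass_cong)
    ultimately show ?thesis using pos[of s x] S[OF that(1)] by auto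
  qed
  \<comment> \<open>Independence of \<open>w\<close> and \<open>x\<close> supplies a point with the
    \<open>w\<close>-value of \<open>t\<close> over the \<open>x\<close>-value of \<open>s\<close>,
    which reduces to the case of a common \<open>x\<close>.\<close>
  have const: "?m w s = ?m w t" if "s \<in> S" "t \<in> S" for s t
  proof -
    have "0 < ?m w t * ?m x s" using that by (intro mult_pos_pos pos S)
    also have "\<dots> = (\<Sum>r\<in>{r\<in>T. w r = w t \<and> x r = x s}. p r)"
      using independence_of_entropies[OF fin p one w_x] S that by simp
    finally have "0 < (\<Sum>r\<in>{r\<in>T. w r = w t \<and> x r = x s}. p r)" .
    from wit[OF this] obtain r where r: "r \<in> S" "w r = w t" "x r = x s" by blast
    have "?m w s = ?m w r" using r that by (intro same_x) auto
    also have "\<dots> = ?m w t" using r by (intro fiber_mass_cong)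
    finally show ?thesis .
  qed
  have finS: "finite S" using fin by (simp add: S_def)
  have sumS: "(\<Sum>s\<in>{s\<in>S. E s}. p s) = (\<Sum>s\<in>{s\<in>T. E s}. p s)" for E
    using fin p by (intro sum.mono_neutral_left) (force simp: S_def less_le)+
  have oneS: "sum p S = 1" using sumS[of "\<lambda>_. True"] one by simp
  then obtain s0 where s0: "s0 \<in> S" by fastforce
  define c where "c = ?m w s0"
  define v where "v = card (w ` S)"
  have c: "0 < c" unfolding c_def using pos S[OF s0] by blast
  have "1 = (\<Sum>u\<in>w ` S. \<Sum>s\<in>{s\<in>S. w s = u}. p s)"
    unfolding oneS[symmetric] using finS by (intro sum.group[symmetric]) auto
  also have "\<dots> = (\<Sum>u\<in>w ` S. c)"
  proof (intro sum.cong refl)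
    fix u assume "u \<in> w ` S"
    then obtain s where s: "s \<in> S" "u = w s" by blast
    then show "(\<Sum>s\<in>{s\<in>S. w s = u}. p s) = c"
      unfolding sumS c_def using const[OF s(1) s0] by (simp add: fiber_mass_def)
  qed
  finally have vc: "real v * c = 1" by (simp add: v_def)
  have "fiber_entropy p T w = - (\<Sum>s\<in>T. p s * log 2 c)"
    unfolding fiber_entropy_def
  proof (intro arg_cong[of _ _ uminus] sum.cong refl)
    fix s assume "s \<in> T"
    then show "p s * log 2 (?m w s) = p s * log 2 c"
      using p[of s] const[OF _ s0, of s] by (cases "p s = 0") (auto simp: c_def S_def)
  qed
  also have "\<dots> = - log 2 c" by (simp add: one flip: sum_distrib_right)
  also have "\<dots> = log 2 (real v)"
  proof -
    have "v \<noteq> 0" using vc by (intro notI) simp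
    moreover from this have "c = 1 / real v" using vc by (simp add: field_simps)
    ultimately show ?thesis by (simp add: log_divide)
  qed
  finally have "fiber_entropy p T w = log 2 (real v)" .
  moreover have "1 \<le> v" using finS s0 by (auto simp: v_def Suc_le_eq card_gt_0_iff)
  ultimately show ?thesis by blast
qed

section \<open>Necessity of the logarithm condition\<close>

lemma face_point_nth:
  "face_point rank_U34 rank_U13_123 a b $ A =
    a * real (min 3 (card A)) + (if A \<inter> {1, 2, 3} = {} then 0 else b)"
proof (cases "A \<inter> {1, 2, 3} = {}")
  case False
  then have "0 < card (A \<inter> {1, 2, 3})" by (simp add: card_gt_0_iff)
  then have "min 1 (card (A \<inter> {1, 2, 3})) = 1" by linarith
  then show ?thesis
    using False by (simp only: face_point_def rank_U34_def rank_U13_123_def) simp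
qed (simp add: face_point_def rank_U34_def rank_U13_123_def)

lemma log_integer_of_entropic:
  assumes "entropic (face_point rank_U34 rank_U13_123 a b)"
  shows "\<exists>v::nat. 1 \<le> v \<and> a = log 2 (real v)"
proof -
  obtain M :: "nat measure" and X :: "4 \<Rightarrow> nat \<Rightarrow> nat" where M: "prob_space M"
    and X': "\<forall>i. simple_function M (X i)"
    and h': "\<forall>A. face_point rank_U34 rank_U13_123 a b $ A = shannon_entropy M (subvector X A)"
    using assms unfolding entropic_def by (elim exE conjE) (rule that)
  note X = X'[rule_format] and h = h'[rule_format]
  interpret prob_space M by fact
  define V where "V = subvector X UNIV"
  define T where "T = V ` space M"
  define p where "p s = measure M (V -` {s} \<inter> space M)" for s
  have V: "simple_function M V" unfolding V_def using X by (rule simple_function_subvector)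
  have fin: "finite T" using V by (simp add: T_def simple_function_def)
  have "sum p T = measure M (\<Union>s\<in>T. V -` {s} \<inter> space M)"
    unfolding p_def using fin V
    by (intro finite_measure_finite_Union[symmetric])
      (auto simp: disjoint_family_on_def intro: simple_functionD)
  also have "(\<Union>s\<in>T. V -` {s} \<inter> space M) = space M" by (auto simp: T_def)
  finally have one: "sum p T = 1" by (simp add: prob_space)
  \<comment> \<open>Allowing any \<open>g\<close> whose kernel is agreement on \<open>A\<close>
    covers tuples of coordinates in any order and bracketing.\<close>
  have H: "fiber_entropy p T g = a * real (min 3 (card A)) + (if A \<inter> {1, 2, 3} = {} then 0 else b)"
    if "\<And>s t. g s = g t \<longleftrightarrow> (\<forall>i\<in>A. s i = t i)" for A and g :: "(4 \<Rightarrow> nat) \<Rightarrow> 'g"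
  proof -
    have "fiber_mass p T g = fiber_mass p T (\<lambda>s. restrict s A)"
      by (rule fiber_mass_kernel) (auto simp: that restrict_def fun_eq_iff)
    then have "fiber_entropy p T g = fiber_entropy p T (\<lambda>s. restrict s A)"
      by (simp add: fiber_entropy_def)
    also have "\<dots> = shannon_entropy M (subvector X A)"
      unfolding T_def
      by (rule shannon_entropy_eq_fiber_entropy[symmetric, OF M V])
        (auto simp: V_def subvector_def p_def fun_eq_iff)
    finally show ?thesis by (simp only: h[symmetric] face_point_nth)
  qed
  have Hw: "fiber_entropy p T (\<lambda>s. s 4) = a"
    by (subst H[of _ "{4}"]) (auto simp: card_4_set)
  have Hx: "fiber_entropy p T (\<lambda>s. s 1) = a + b"
    by (subst H[of _ "{1}"]) (auto simp: card_4_set)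
  have Hwx: "fiber_entropy p T (\<lambda>s. (s 4, s 1)) = 2 * a + b"
    by (subst H[of _ "{4, 1}"]) (auto simp: card_4_set)
  have Hxy: "fiber_entropy p T (\<lambda>s. (s 1, s 2)) = 2 * a + b"
    by (subst H[of _ "{1, 2}"]) (auto simp: card_4_set)
  have Hxz: "fiber_entropy p T (\<lambda>s. (s 1, s 3)) = 2 * a + b"
    by (subst H[of _ "{1, 3}"]) (auto simp: card_4_set)
  have Hxyz: "fiber_entropy p T (\<lambda>s. (s 1, s 2, s 3)) = 3 * a + b"
    by (subst H[of _ "{1, 2, 3}"]) (auto simp: card_4_set)
  have Hwxy: "fiber_entropy p T (\<lambda>s. (s 4, s 1, s 2)) = 3 * a + b"
    by (subst H[of _ "{4, 1, 2}"]) (auto simp: card_4_set)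
  have Hwxz: "fiber_entropy p T (\<lambda>s. (s 4, s 1, s 3)) = 3 * a + b"
    by (subst H[of _ "{4, 1, 3}"]) (auto simp: card_4_set)
  have Hwxyz: "fiber_entropy p T (\<lambda>s. (s 4, s 1, s 2, s 3)) = 3 * a + b"
    by (subst H[of _ "{4, 1, 2, 3}"]) (auto simp: card_4_set)
  \<comment> \<open>The values above give the required equalities, for instance
    \<open>(2 * a + b) + (2 * a + b) = (3 * a + b) + (a + b)\<close> for \<open>y\<close> and
    \<open>z\<close> given \<open>x\<close>.\<close>
  have "\<exists>v::nat. 1 \<le> v \<and> fiber_entropy p T (\<lambda>s. s 4) = log 2 (real v)"
    by (rule entropy_eq_log_card_of_tight[OF fin _ one,
        where x = "\<lambda>s. s 1" and y = "\<lambda>s. s 2" and z = "\<lambda>s. s 3"])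
      (simp_all add: p_def Hw Hx Hwx Hxy Hxz Hxyz Hwxy Hwxz Hwxyz)
  then show ?thesis by (simp add: Hw)
qed

section \<open>Distributions of prescribed entropy\<close>

text \<open>The value 0 at 0 agrees with the limit from the right. Continuity up to 0 is what allows
  a path of distributions to start at a point mass.\<close>

lemma continuous_on_mult_log: "continuous_on {0..} (\<lambda>x::real. x * log 2 x)"
proof -
  have "((\<lambda>x::real. x * log 2 x) \<longlongrightarrow> 0 * log 2 0) (at 0 within {0..})"
    unfolding at_within_Ici_at_right by real_asymp
  moreover have "continuous (at x within {0..}) (\<lambda>x::real. x * log 2 x)" if "0 < x" for x
    using that by (intro continuous_intros) auto
  ultimately show ?thesis
    by (auto simp: continuous_on_eq_continuous_within continuous_within le_less)
qed

text \<open>By the intermediate value theorem: a point mass has entropy 0, and the uniform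
  distribution on \<open>n\<close> points has entropy at least \<open>b\<close> once
  \<open>n\<close> is at least \<open>2 powr b\<close>.\<close>

lemma exists_distribution_with_entropy:
  fixes b :: real
  assumes "0 \<le> b"
  shows "\<exists>(n::nat) w. (\<forall>j<n. 0 \<le> w j) \<and> (\<Sum>j<n. w j) = 1 \<and>
    - (\<Sum>j<n. w j * log 2 (w j)) = b"
proof -
  define n :: nat where "n = nat \<lceil>2 powr b\<rceil>"
  have "2 powr b \<le> real n" by (simp add: n_def real_nat_ceiling_ge)
  moreover have "1 \<le> 2 powr b" using assms by (simp add: ge_one_powr_ge_zero)
  ultimately have n: "0 < n" "b \<le> log 2 (real n)" by (auto simp: le_log_iff)
  \<comment> \<open>interpolates between a point mass and the uniform distribution on \<open>n\<close> points\<close>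
  define w where "w t j = (1 - t) * of_bool (j = 0) + t / real n" for t :: real and j :: nat
  define E where "E t = - (\<Sum>j<n. w t j * log 2 (w t j))" for t
  have w: "0 \<le> w t j" if "t \<in> {0..1}" for t j using that by (simp add: w_def)
  have "\<exists>t. 0 \<le> t \<and> t \<le> 1 \<and> E t = b"
  proof (rule IVT')
    have "w 0 j * log 2 (w 0 j) = 0" for j by (simp add: w_def)
    then have "E 0 = 0" unfolding E_def by (simp only: sum.neutral_const minus_zero)
    then show "E 0 \<le> b" using assms by simp
    have "E 1 = log 2 (real n)" using n by (simp add: E_def w_def log_divide)
    then show "b \<le> E 1" using n by simp
    show "continuous_on {0..1} E"
      unfolding E_def
      by (intro continuous_intros continuous_on_compose2[OF continuous_on_mult_log])
        (use w in \<open>auto simp: w_def intro!: continuous_intros\<close>)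
  qed simp
  then obtain t where t: "t \<in> {0..1}" "E t = b" by auto
  have "(\<Sum>j<n. w t j) = (1 - t) * (\<Sum>j<n. of_bool (j = 0)) + t"
    using n by (simp add: w_def sum.distrib flip: sum_distrib_left)
  also have "(\<Sum>j<n. of_bool (j = 0)) = (1::real)" using n by (simp add: of_bool_def)
  finally show ?thesis
    using w t unfolding E_def by (intro exI[of _ n] exI[of _ "w t"]) auto
qed

section \<open>Construction from zero-sum vectors\<close>

text \<open>Elements of the integers modulo \<open>v\<close> are represented by their least
  residues, so that \<open>v\<close> can remain a variable.\<close>

definition zero_sum_vectors :: "int \<Rightarrow> ('i::finite \<Rightarrow> int) set" where
  "zero_sum_vectors v = {z. (\<forall>i. z i \<in> {0..<v}) \<and> v dvd (\<Sum>i\<in>UNIV. z i)}"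

lemma finite_zero_sum_vectors: "finite (zero_sum_vectors v)"
proof (rule finite_subset)
  show "zero_sum_vectors v \<subseteq> (\<Pi>\<^sub>E i\<in>UNIV. {0..<v})"
    by (auto simp: zero_sum_vectors_def)
qed (auto intro: finite_PiE)

text \<open>All coordinates but one are free, and those in \<open>A\<close> are prescribed by
  \<open>y\<close>. For \<open>A = UNIV\<close> the truncated exponent is 0, and \<open>y\<close>
  itself must have zero sum for the count 1 to be right.\<close>

lemma card_zero_sum_vectors_fiber:
  fixes y :: "'i::finite \<Rightarrow> int"
  assumes v: "1 \<le> v" and y: "\<And>i. y i \<in> {0..<v}" "A = UNIV \<Longrightarrow> v dvd (\<Sum>i\<in>UNIV. y i)"
  shows "card {z \<in> zero_sum_vectors v. \<forall>i\<in>A. z i = y i} = nat v ^ (CARD('i) - 1 - card A)"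
proof (cases "A = UNIV")
  case True
  then have "{z \<in> zero_sum_vectors v. \<forall>i\<in>A. z i = y i} = {y}"
    using y by (auto simp: zero_sum_vectors_def)
  then show ?thesis using True by simp
next
  case False
  then obtain k where k: "k \<notin> A" by blast
  \<comment> \<open>the coordinates in \<open>B\<close> are free; the one at \<open>k\<close> is then forced by the zero sum\<close>
  define B where "B = UNIV - insert k A"
  have kB: "k \<notin> B" "UNIV - {k} = A \<union> B" "A \<inter> B = {}" using k by (auto simp: B_def)
  have cB: "card B = CARD('i) - 1 - card A"
    using k by (simp add: B_def card_Diff_subset)
  have split: "(\<Sum>i\<in>UNIV. z i) = z k + (\<Sum>i\<in>UNIV - {k}. z i)" for z :: "'i \<Rightarrow> int"
    by (rule sum.remove) auto
  have "bij_betw (\<lambda>z. restrict z B) {z \<in> zero_sum_vectors v. \<forall>i\<in>A. z i = y i} (\<Pi>\<^sub>E i\<in>B. {0..<v})"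
  proof (rule bij_betwI')
    fix z z' assume z: "z \<in> {z \<in> zero_sum_vectors v. \<forall>i\<in>A. z i = y i}"
      and z': "z' \<in> {z \<in> zero_sum_vectors v. \<forall>i\<in>A. z i = y i}"
    have "z = z'" if eq: "restrict z B = restrict z' B"
    proof -
      have off: "z i = z' i" if "i \<noteq> k" for i
      proof (cases "i \<in> A")
        case True
        then show ?thesis using z z' by simp
      next
        case False
        then have "i \<in> B" using that by (simp add: B_def)
        then show ?thesis using fun_cong[OF eq, of i] by simp
      qed
      \<comment> \<open>Agreement off \<open>k\<close> makes the last coordinates congruent modulo
        \<open>v\<close>; as least residues they are then equal.\<close>
      have "v dvd (\<Sum>i\<in>UNIV. z i) - (\<Sum>i\<in>UNIV. z' i)"
        using z z' by (simp add: zero_sum_vectors_def)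
      also have "(\<Sum>i\<in>UNIV. z i) - (\<Sum>i\<in>UNIV. z' i) = z k - z' k"
        unfolding split using off by simp
      finally have "z k mod v = z' k mod v" by (simp add: mod_eq_dvd_iff)
      then have "z k = z' k" using z z' by (simp add: zero_sum_vectors_def)
      then show ?thesis using off by (metis ext)
    qed
    then show "restrict z B = restrict z' B \<longleftrightarrow> z = z'" by auto
  next
    fix z assume "z \<in> {z \<in> zero_sum_vectors v. \<forall>i\<in>A. z i = y i}"
    then show "restrict z B \<in> (\<Pi>\<^sub>E i\<in>B. {0..<v})" by (auto simp: zero_sum_vectors_def)
  next
    fix u assume u: "u \<in> (\<Pi>\<^sub>E i\<in>B. {0..<v})"
    define f where "f i = (if i \<in> A then y i else u i)" for i
    define z where "z = f(k := - (\<Sum>i\<in>UNIV - {k}. f i) mod v)"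
    have "f i \<in> {0..<v}" if "i \<noteq> k" for i
      using that y u k by (auto simp: f_def B_def PiE_iff)
    then have "z i \<in> {0..<v}" for i using v by (auto simp: z_def)
    moreover have "v dvd (\<Sum>i\<in>UNIV. z i)"
    proof -
      have "(\<Sum>i\<in>UNIV. z i) = - (\<Sum>i\<in>UNIV - {k}. f i) mod v + (\<Sum>i\<in>UNIV - {k}. f i)"
        unfolding split by (simp add: z_def)
      then show ?thesis by (simp add: mod_0_imp_dvd mod_simps)
    qed
    moreover have "\<forall>i\<in>A. z i = y i" using k by (auto simp: z_def f_def)
    moreover have "u = restrict z B"
      using u kB by (auto simp: fun_eq_iff z_def f_def restrict_def PiE_iff extensional_def)
    ultimately show "\<exists>z\<in>{z \<in> zero_sum_vectors v. \<forall>i\<in>A. z i = y i}. u = restrict z B"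
      by (auto simp: zero_sum_vectors_def)
  qed
  then have "card {z \<in> zero_sum_vectors v. \<forall>i\<in>A. z i = y i} = card (\<Pi>\<^sub>E i\<in>B. {0..<v})"
    by (rule bij_betw_same_card)
  also have "\<dots> = nat v ^ card B" by (simp add: card_PiE)
  finally show ?thesis by (simp add: cB)
qed

text \<open>Any three coordinates of a uniform zero-sum vector are independent and uniform and
  determine the fourth, giving \<open>min 3 (card A)\<close> times \<open>log 2 v\<close>. The
  common component \<open>J\<close> is visible, and adds \<open>b\<close>, exactly when
  \<open>A\<close> meets \<open>{1, 2, 3}\<close>.\<close>

lemma entropic_of_log_integer:
  fixes v :: int
  assumes b: "0 \<le> b" and v: "1 \<le> v"
  shows "entropic (face_point rank_U34 rank_U13_123 (log 2 (of_int v)) b)"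
proof -
  obtain n :: nat and w where w: "\<forall>j<n. 0 \<le> w j" "(\<Sum>j<n. w j) = 1"
    "- (\<Sum>j<n. w j * log 2 (w j)) = b"
    using exists_distribution_with_entropy[OF b] by blast
  define r where "r = real_of_int v"
  have r: "1 \<le> r" "real (nat v) = r" using v by (auto simp: r_def)
  define Z :: "(4 \<Rightarrow> int) set" where "Z = zero_sum_vectors v"
  define T where "T = {..<n} \<times> Z"
  \<comment> \<open>There are \<open>r ^ 3\<close> zero-sum vectors, so this is the product of
    \<open>w\<close> with the uniform law.\<close>
  define p where "p = (\<lambda>(j, z :: 4 \<Rightarrow> int). w j / r ^ 3)"
  \<comment> \<open>The constant 0 in place of \<open>j\<close> gives the fourth variable the same
    type as the others.\<close>
  define X where "X i = (\<lambda>(j, z). if i = 4 then (0, z 4) else (j :: nat, z i :: int))" for i :: 4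
  define M where "M = point_measure T (\<lambda>s. ennreal (p s))"
  have finZ: "finite Z" unfolding Z_def by (rule finite_zero_sum_vectors)
  then have finT: "finite T" by (simp add: T_def)
  have p: "0 \<le> p s" if "s \<in> T" for s using that w r by (auto simp: T_def p_def)
  have cardZ: "real (card {z'\<in>Z. \<forall>i\<in>A. z' i = z i}) = r ^ 3 / r ^ min 3 (card A)" if "z \<in> Z" for z A
  proof -
    have "card {z'\<in>Z. \<forall>i\<in>A. z' i = z i} = nat v ^ (3 - card A)"
      unfolding Z_def using that v
      by (subst card_zero_sum_vectors_fiber) (auto simp: Z_def zero_sum_vectors_def)
    also have "3 - card A = 3 - min 3 (card A)" by simp
    finally have "real (card {z'\<in>Z. \<forall>i\<in>A. z' i = z i}) = r ^ (3 - min 3 (card A))"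
      by (simp only: of_nat_power r)
    also have "\<dots> = r ^ 3 / r ^ min 3 (card A)" using r by (intro power_diff) auto
    finally show ?thesis .
  qed
  have cZ: "real (card Z) = r ^ 3"
  proof -
    have "(\<lambda>_. 0) \<in> Z" using v by (simp add: Z_def zero_sum_vectors_def)
    from cardZ[OF this, of "{}"] show ?thesis by simp
  qed
  have mass_prod: "(\<Sum>s\<in>J \<times> K. p s) = (\<Sum>j\<in>J. w j) * real (card K) / r ^ 3" for J K
    by (simp add: p_def sum.cartesian_product[symmetric] sum_distrib_right sum_divide_distrib mult.commute)
  have one: "sum p T = 1" using r by (simp add: T_def mass_prod cZ w)
  have M: "prob_space M"
  proof
    have "emeasure M (space M) = (\<Sum>s\<in>T. ennreal (p s))"
      unfolding M_def by (simp add: space_point_measure emeasure_point_measure_finite finT)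
    also have "\<dots> = 1" using p by (simp add: sum_ennreal one)
    finally show "emeasure M (space M) = 1" .
  qed
  have simple: "simple_function M g" for g :: "_ \<Rightarrow> 'g"
    using finT by (simp add: M_def simple_function_def space_point_measure sets_point_measure)
  have space: "space M = T" by (simp add: M_def space_point_measure)
  have point_mass: "p s = measure M ((\<lambda>s. s) -` {s} \<inter> T)" if "s \<in> T" for s
  proof -
    have "(\<lambda>s. s) -` {s} \<inter> T = {s}" using that by auto
    then show ?thesis
      using that p finT unfolding M_def by (simp add: measure_point_measure_finite_if)
  qed
  have "shannon_entropy M (subvector X A) =
      log 2 (of_int v) * real (min 3 (card A)) + (if A \<inter> {1, 2, 3} = {} then 0 else b)" for A
  proof -
    let ?k = "min 3 (card A)"
    \<comment> \<open>This is the probability of what \<open>A\<close> sees of \<open>J\<close>: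
      nothing, or the value \<open>j\<close>.\<close>
    define W where "W j = (if A \<inter> {1, 2, 3} = {} then 1 else w j)" for j
    have mass: "fiber_mass p T (subvector X A) (j, z) = W j / r ^ ?k" if "(j, z) \<in> T" for j z
    proof -
      have iff: "subvector X A (j', z') = subvector X A (j, z) \<longleftrightarrow>
          (A \<inter> {1, 2, 3} \<noteq> {} \<longrightarrow> j' = j) \<and> (\<forall>i\<in>A. z' i = z i)" for j' z'
      proof -
        have "subvector X A (j', z') = subvector X A (j, z) \<longleftrightarrow>
            (\<forall>i\<in>A. (i \<noteq> 4 \<longrightarrow> j' = j) \<and> z' i = z i)"
          by (auto simp: subvector_def restrict_def fun_eq_iff X_def)
        moreover have "i \<noteq> 4 \<longleftrightarrow> i \<in> {1, 2, 3}" for i :: 4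
          using exhaust_4[of i] by auto
        ultimately show ?thesis by blast
      qed
      have "{t\<in>T. subvector X A t = subvector X A (j, z)} =
          (if A \<inter> {1, 2, 3} = {} then {..<n} else {j}) \<times> {z'\<in>Z. \<forall>i\<in>A. z' i = z i}"
        using that iff by (auto simp: T_def)
      then show ?thesis
        using that r w by (simp add: fiber_mass_def mass_prod cardZ W_def T_def)
    qed
    have "shannon_entropy M (subvector X A) = fiber_entropy p T (subvector X A)"
      using shannon_entropy_eq_fiber_entropy[OF M simple, where V = "\<lambda>s. s"
          and Y = "subvector X A" and g = "subvector X A" and p = p] point_mass
      by (simp add: space)
    also have "\<dots> = - (\<Sum>s\<in>T. p s * (log 2 (W (fst s)) - ?k * log 2 r))"
      unfolding fiber_entropy_def
    proof (intro arg_cong[of _ _ uminus] sum.cong refl)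
      fix s assume s: "s \<in> T"
      obtain j z where jz: "s = (j, z)" by (cases s)
      show "p s * log 2 (fiber_mass p T (subvector X A) s) = p s * (log 2 (W (fst s)) - ?k * log 2 r)"
      \<comment> \<open>The logarithm is expanded only at positive weight; elsewhere the factor
        \<open>p s\<close> is 0.\<close>
      proof (cases "w j = 0")
        case False
        then have "0 < W j" using w(1) s by (auto simp: W_def T_def jz less_le)
        then show ?thesis using mass s r by (simp add: jz log_divide log_nat_power)
      qed (simp add: jz p_def)
    qed
    also have "\<dots> = ?k * log 2 r - (\<Sum>s\<in>T. p s * log 2 (W (fst s)))"
      by (simp add: right_diff_distrib sum_subtractf one flip: sum_distrib_right)
    also have "(\<Sum>s\<in>T. p s * log 2 (W (fst s))) = (\<Sum>j<n. \<Sum>z\<in>Z. w j / r ^ 3 * log 2 (W j))"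
      unfolding T_def p_def sum.cartesian_product by (simp add: case_prod_unfold)
    also have "\<dots> = (\<Sum>j<n. w j * log 2 (W j))" using r by (simp add: cZ)
    also have "\<dots> = (if A \<inter> {1, 2, 3} = {} then 0 else - b)"
      using w(3) by (auto simp: W_def)
    finally show ?thesis by (auto simp: r_def)
  qed
  then show ?thesis
    \<comment> \<open>The outcomes are pairs here; \<open>entropicI\<close> re-encodes outcomes and
      values as natural numbers.\<close>
    by (intro entropicI[OF M, of X] simple) (simp add: face_point_nth)
qed

theorem mainTheorem16:
  fixes a b :: real
  assumes "0 \<le> a" and "0 \<le> b"
  shows "entropic (face_point rank_U34 rank_U13_123 a b) \<longleftrightarrow>
    (\<exists>v :: int. 1 \<le> v \<and> a = log 2 (of_int v))"
proof
  assume "entropic (face_point rank_U34 rank_U13_123 a b)"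
  then obtain v :: nat where "1 \<le> v" "a = log 2 (real v)"
    using log_integer_of_entropic by blast
  then show "\<exists>v :: int. 1 \<le> v \<and> a = log 2 (of_int v)"
    by (intro exI[of _ "int v"]) simp
next
  assume "\<exists>v :: int. 1 \<le> v \<and> a = log 2 (of_int v)"
  then show "entropic (face_point rank_U34 rank_U13_123 a b)"
    using entropic_of_log_integer[OF assms(2)] by blast
qed

end
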